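(* Let $X$ be a Banach space and $\kappa$ an infinite cardinal. Consider the following statements: (a) $X$ fails the $(-1)$-BCP$_{<\kappa}$; (b) $X^*$ has the weak$^*$ 1-ASD2P$_{<\kappa}$; (c) for every set $A\subset S_X$ of cardinality strictly smaller than $\kappa$ there is $x^{**}\in S_{X^{**}}$ such that $\|x+x^{**}\|=2$ for every $x\in A$; (d) $X^*$ has the weak$^*$ SD2P$_{<\kappa}$. Then (a) implies (b), (b) implies (c), and (c) implies (d).
   Context: Banach spaces are real and infinite-dimensional. $S_X$ is the unit sphere of $X$ and $X^*$ the topological dual; $X$ is regarded as a subspace of $X^{**}$ canonically. For a normed space $X$, $B\subset X$, $A\subset X^*$ and $\lambda\in(0,1)$, $B$ $\lambda$-norms $A$ if for every $x^*\in A$ there is $x\in B\setminus\{0\}$ with $x^*(x)\ge\lambda\|x^*\|\|x\|$; $B$ norms $A$ if $B$ $\lambda$-norms $A$ for every $\lambda\in(0,1)$. For a subspace $Y\subset X^*$ and an infinite cardinal $\kappa$: - the couple $(X,Y)$ has the SD2P$_{<\kappa}$ if for every set $A\subset S_Y$ of cardinality strictly smaller than $\kappa$ and every $\lambda\in(0,1)$ there are $B\subset S_X$ and $x^*\in S_{X^*}$ such that $B$ $\lambda$-norms $A$ and $x^*(x)\ge\lambda$ for every $x\in B$; - the couple $(X,Y)$ has the 1-ASD2P$_{<\kappa}$ if for every set $A\subset S_Y$ of cardinality strictly smaller than $\kappa$ there are $B\subset S_X$ and $x^*\in S_{X^*}$ such that $B$ norms $A$ and $x^*(x)=1$ for every $x\in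 B$. $X^*$ has the weak$^*$ version of either property if the couple $(X^*,X)$ has that property. A normed space $Z$ fails the $(-1)$-BCP$_{<\kappa}$, for $\kappa$ uncountable, if for every subspace $Y\subset Z$ of density character strictly smaller than $\kappa$ there is $z\in S_Z$ such that $\|y+\lambda z\|\ge\|y\|+|\lambda|$ for every $y\in Y$ and $\lambda\in\mathbb R$. (For uncountable $\kappa$ this is equivalent to: for every $A\subset S_Z$ of cardinality strictly smaller than $\kappa$ there is $z\in S_Z$ with $\|x+z\|=2$ for all $x\in A$.) For $\kappa=\omega$ it means: for every finite $A\subset S_Z$ there is $z\in S_Z$ with $\|x+z\|=2$ for all $x\in A$. *)

theory Defs
  imports "HOL-Analysis.Analysis"
begin

unbundle cardinal_syntax

text \<open>
  The dual of \<open>'a\<close> is the type \<open>'a \<Rightarrow>\<^sub>L real\<close> with its operator norm. Cardinals are cardinal orders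
  \<open>\<kappa> :: 'k rel\<close> over an arbitrary type, compared by \<open><o\<close>, \<open>\<le>o\<close> and \<open>=o\<close>.
\<close>

definition bidual_embed :: "'a::real_normed_vector \<Rightarrow> (('a \<Rightarrow>\<^sub>L real) \<Rightarrow>\<^sub>L real)"
  where "bidual_embed x = Blinfun (\<lambda>f. blinfun_apply f x)"

lemma bidual_embed_apply [simp]: "blinfun_apply (bidual_embed x) f = blinfun_apply f x"
  unfolding bidual_embed_def
  by (simp add: bounded_linear_Blinfun_apply blinfun.bounded_linear_left)

definition lnorms :: "real \<Rightarrow> 'a::real_normed_vector set \<Rightarrow> ('a \<Rightarrow>\<^sub>L real) set \<Rightarrow> bool"
  where "lnorms l B A \<longleftrightarrow>
    (\<forall>f\<in>A. \<exists>x\<in>B - {0}. blinfun_apply f x \<ge> l * norm f * norm x)"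

definition norms :: "'a::real_normed_vector set \<Rightarrow> ('a \<Rightarrow>\<^sub>L real) set \<Rightarrow> bool"
  where "norms B A \<longleftrightarrow> (\<forall>l\<in>{0<..<1}. lnorms l B A)"

text \<open>
  The properties of the couple \<open>(X, Y)\<close>: the space \<open>X\<close> is the whole type \<open>'a\<close>, and \<open>Y\<close> is meant to
  be a linear subspace of its dual.
\<close>

definition SD2P_lt :: "('a::real_normed_vector \<Rightarrow>\<^sub>L real) set \<Rightarrow> 'k rel \<Rightarrow> bool"
  where "SD2P_lt Y \<kappa> \<longleftrightarrow>
    (\<forall>A. A \<subseteq> sphere 0 1 \<inter> Y \<and> |A| <o \<kappa> \<longrightarrow>
      (\<forall>l\<in>{0<..<1}. \<exists>(B :: 'a set) (f :: 'a \<Rightarrow>\<^sub>L real). B \<subseteq> sphere 0 1 \<and> f \<in> sphere 0 1 \<and>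
        lnorms l B A \<and> (\<forall>x\<in>B. blinfun_apply f x \<ge> l)))"

definition one_ASD2P_lt :: "('a::real_normed_vector \<Rightarrow>\<^sub>L real) set \<Rightarrow> 'k rel \<Rightarrow> bool"
  where "one_ASD2P_lt Y \<kappa> \<longleftrightarrow>
    (\<forall>A. A \<subseteq> sphere 0 1 \<inter> Y \<and> |A| <o \<kappa> \<longrightarrow>
      (\<exists>(B :: 'a set) (f :: 'a \<Rightarrow>\<^sub>L real). B \<subseteq> sphere 0 1 \<and> f \<in> sphere 0 1 \<and>
        norms B A \<and> (\<forall>x\<in>B. blinfun_apply f x = 1)))"

text \<open>
  In the weak* versions the argument \<open>TYPE('a)\<close> stands for the predual \<open>X\<close>; the property is one of
  the dual of \<open>X\<close>.
\<close>

definition weak_star_SD2P_lt :: "'a::real_normed_vector itself \<Rightarrow> 'k rel \<Rightarrow> bool"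
  where "weak_star_SD2P_lt _ \<kappa> \<longleftrightarrow>
    SD2P_lt (range (bidual_embed :: 'a \<Rightarrow> (('a \<Rightarrow>\<^sub>L real) \<Rightarrow>\<^sub>L real))) \<kappa>"

definition weak_star_one_ASD2P_lt :: "'a::real_normed_vector itself \<Rightarrow> 'k rel \<Rightarrow> bool"
  where "weak_star_one_ASD2P_lt _ \<kappa> \<longleftrightarrow>
    one_ASD2P_lt (range (bidual_embed :: 'a \<Rightarrow> (('a \<Rightarrow>\<^sub>L real) \<Rightarrow>\<^sub>L real))) \<kappa>"

definition dense_subsets :: "'a::topological_space set \<Rightarrow> 'a set set"
  where "dense_subsets Y = {D. D \<subseteq> Y \<and> Y \<subseteq> closure D}"

text \<open>
  Cardinal orders are only unique up to \<open>=o\<close>, so the choice operator picks a representative of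
  the least cardinality of a dense subset.
\<close>

definition density_character :: "'a::topological_space set \<Rightarrow> 'a rel"
  where "density_character Y =
    (SOME r. r \<in> card_of ` dense_subsets Y \<and> (\<forall>E\<in>dense_subsets Y. r \<le>o |E| ))"

lemma density_character:
  "density_character Y \<in> card_of ` dense_subsets Y"
  "E \<in> dense_subsets Y \<Longrightarrow> density_character Y \<le>o |E|"
proof -
  have "Y \<in> dense_subsets Y"
    by (simp add: dense_subsets_def closure_subset)
  then have "\<exists>r\<in>card_of ` dense_subsets Y. \<forall>r'\<in>card_of ` dense_subsets Y. r \<le>o r'"
    by (intro exists_minim_Card_order) (auto simp: card_of_Card_order)
  then have "\<exists>r. r \<in> card_of ` dense_subsets Y \<and> (\<forall>E\<in>dense_subsets Y. r \<le>o |E| )"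
    by blast
  from someI_ex[OF this] show "density_character Y \<in> card_of ` dense_subsets Y"
    "E \<in> dense_subsets Y \<Longrightarrow> density_character Y \<le>o |E|"
    unfolding density_character_def by blast+
qed

lemma density_character_less_iff:
  "density_character Y <o \<kappa> \<longleftrightarrow> (\<exists>D. D \<subseteq> Y \<and> Y \<subseteq> closure D \<and> |D| <o \<kappa>)"
proof
  assume "density_character Y <o \<kappa>"
  then show "\<exists>D. D \<subseteq> Y \<and> Y \<subseteq> closure D \<and> |D| <o \<kappa>"
    using density_character(1)[of Y] by (auto simp: dense_subsets_def)
next
  assume "\<exists>D. D \<subseteq> Y \<and> Y \<subseteq> closure D \<and> |D| <o \<kappa>"
  then show "density_character Y <o \<kappa>"
    using density_character(2)[of _ Y] ordLeq_ordLess_trans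
    unfolding dense_subsets_def by blast
qed

definition fails_minus_one_BCP_lt :: "'z::real_normed_vector itself \<Rightarrow> 'k rel \<Rightarrow> bool"
  where "fails_minus_one_BCP_lt _ \<kappa> \<longleftrightarrow>
    (natLeq <o \<kappa> \<longrightarrow>
      (\<forall>Y::'z set. subspace Y \<and> density_character Y <o \<kappa> \<longrightarrow>
        (\<exists>z\<in>sphere 0 1. \<forall>y\<in>Y. \<forall>t::real. norm (y + t *\<^sub>R z) \<ge> norm y + \<bar>t\<bar>))) \<and>
    (\<kappa> =o natLeq \<longrightarrow>
      (\<forall>A::'z set. finite A \<and> A \<subseteq> sphere 0 1 \<longrightarrow>
        (\<exists>z\<in>sphere 0 1. \<forall>x\<in>A. norm (x + z) = 2)))"

end

theory Submission
  imports Defs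
begin

text \<open>
  Two unit vectors \<open>u\<close>, \<open>v\<close> satisfy \<open>\<parallel>u + v\<parallel> = 2\<close> exactly when a functional of norm one can be
  brought arbitrarily close to \<open>1\<close> at \<open>u\<close> and at \<open>v\<close> simultaneously, because two numbers bounded by
  \<open>1\<close> add up to nearly \<open>2\<close> only if both are nearly \<open>1\<close>. The properties in (b) and (d) speak of the
  functionals, those in (a) and (c) of the norm of the sum: \<open>B\<close> norms \<open>A\<close> while \<open>x**\<close> is large on
  \<open>B\<close> if every \<open>x \<in> A\<close> has an \<open>f \<in> B\<close> that is large at \<open>x\<close> and at \<open>x**\<close>.

  If (a) holds and \<open>\<kappa>\<close> is uncountable, the span of \<open>A\<close> still has density character less than \<open>\<kappa>\<close>
  (\<open>density_character_span_less\<close>), which gives a unit vector \<open>z\<close> of \<open>X\<close> with \<open>\<parallel>x + z\<parallel> = 2\<close> for all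
  \<open>x \<in> A\<close>; for \<open>\<kappa> = \<omega>\<close> the set \<open>A\<close> is finite and such a \<open>z\<close> is given directly. By Hahn--Banach
  (\<open>norming_functional\<close>) each \<open>x + z\<close> has a functional attaining its norm, and that functional must
  be \<open>1\<close> both at \<open>x\<close> and at \<open>z\<close>. This is (b) with \<open>z\<close> in the role of \<open>x**\<close>. From (b), testing
  \<open>x + x**\<close> against \<open>B\<close> gives (c). In (c) the norm of \<open>x + x**\<close> need not be attained, so only
  functionals nearly attaining it are available, and these give (d).

  The Hahn--Banach theorem is obtained from a pointwise minimal sublinear functional, which is
  automatically linear.
\<close>

section \<open>The Hahn--Banach theorem by minimal sublinear functionals\<close>

definition sublinear :: "('a::real_vector \<Rightarrow> real) \<Rightarrow> bool"
  where "sublinear q \<longleftrightarrow> (\<forall>x y. q (x + y) \<le> q x + q y) \<and> (\<forall>c\<ge>0. \<forall>x. q (c *\<^sub>R x) = c * q x)"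

lemma sublinearD:
  assumes "sublinear q"
  shows "q (x + y) \<le> q x + q y" and "c \<ge> 0 \<Longrightarrow> q (c *\<^sub>R x) = c * q x"
  using assms by (auto simp: sublinear_def)

text \<open>
  One inequality suffices for positive homogeneity: the other one follows by scaling back with
  \<open>1 / c\<close>.
\<close>

lemma sublinearI:
  fixes q :: "'a::real_vector \<Rightarrow> real"
  assumes add: "\<And>x y. q (x + y) \<le> q x + q y"
    and scale: "\<And>c x. c \<ge> 0 \<Longrightarrow> q (c *\<^sub>R x) \<le> c * q x"
  shows "sublinear q"
proof -
  have "q (c *\<^sub>R x) = c * q x" if "c \<ge> 0" for c x
  proof (cases "c = 0")
    case True
    have "q 0 \<le> q 0 + q 0"
      using add[of 0 0] by simp
    moreover have "q 0 \<le> 0"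
      using scale[of 0 0] by simp
    ultimately show ?thesis
      using True by simp
  next
    case False
    then have "c > 0"
      using that by simp
    have "q x \<le> (1 / c) * q (c *\<^sub>R x)"
      using scale[of "1 / c" "c *\<^sub>R x"] \<open>c > 0\<close> by simp
    then have "c * q x \<le> q (c *\<^sub>R x)"
      using \<open>c > 0\<close> by (simp add: field_simps)
    then show ?thesis
      using scale[OF that, of x] by simp
  qed
  then show ?thesis
    using add by (simp add: sublinear_def)
qed

lemma sublinear_norm: "sublinear (norm :: 'a::real_normed_vector \<Rightarrow> real)"
  by (rule sublinearI) (auto simp: norm_triangle_ineq)

lemma sublinear_zero: "sublinear q \<Longrightarrow> q 0 = 0"
  using sublinearD(2)[of q 0 0] by simp

lemma sublinear_minus_le: "sublinear q \<Longrightarrow> - q (- x) \<le> q x"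
  using sublinearD(1)[of q x "- x"] sublinear_zero[of q] by simp

text \<open>
  The largest sublinear functional below \<open>q\<close> whose value at \<open>- y\<close> is at most \<open>- q y\<close>.
\<close>

definition flatten :: "('a::real_vector \<Rightarrow> real) \<Rightarrow> 'a \<Rightarrow> 'a \<Rightarrow> real"
  where "flatten q y x = (INF t\<in>{0..}. q (x + t *\<^sub>R y) - t * q y)"

lemma flatten_bdd_below:
  assumes "sublinear q"
  shows "bdd_below ((\<lambda>t. q (x + t *\<^sub>R y) - t * q y) ` {0..})"
proof (rule bdd_belowI2)
  fix t :: real
  assume "t \<in> {0..}"
  then have "t * q y = q ((x + t *\<^sub>R y) + - x)"
    using sublinearD(2)[OF assms, of t y] by simp
  also have "\<dots> \<le> q (x + t *\<^sub>R y) + q (- x)"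
    by (rule sublinearD(1)[OF assms])
  finally show "- q (- x) \<le> q (x + t *\<^sub>R y) - t * q y"
    by simp
qed

lemma flatten_lower:
  assumes "sublinear q" and "t \<ge> 0"
  shows "flatten q y x \<le> q (x + t *\<^sub>R y) - t * q y"
  unfolding flatten_def
  using assms by (intro cINF_lower flatten_bdd_below) auto

lemma flatten_greatest:
  assumes "\<And>t. t \<ge> 0 \<Longrightarrow> m \<le> q (x + t *\<^sub>R y) - t * q y"
  shows "m \<le> flatten q y x"
  unfolding flatten_def using assms by (intro cINF_greatest) auto

lemma flatten_le:
  assumes "sublinear q"
  shows "flatten q y x \<le> q x"
  using flatten_lower[OF assms, of 0 y x] by simp

lemma sublinear_flatten:
  fixes q :: "'a::real_vector \<Rightarrow> real"
  assumes q: "sublinear q"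
  shows "sublinear (flatten q y)"
proof (rule sublinearI)
  fix x x' :: 'a
  have sum_lower: "flatten q y (x + x') \<le>
      (q (x + s *\<^sub>R y) - s * q y) + (q (x' + t *\<^sub>R y) - t * q y)" if "s \<ge> 0" "t \<ge> 0" for s t
  proof -
    have "flatten q y (x + x') \<le> q ((x + x') + (s + t) *\<^sub>R y) - (s + t) * q y"
      using that by (intro flatten_lower q) auto
    moreover have "q ((x + x') + (s + t) *\<^sub>R y) \<le> q (x + s *\<^sub>R y) + q (x' + t *\<^sub>R y)"
      using sublinearD(1)[OF q, of "x + s *\<^sub>R y" "x' + t *\<^sub>R y"]
      by (simp add: algebra_simps)
    ultimately show ?thesis
      by (simp add: algebra_simps)
  qed
  have "flatten q y (x + x') - (q (x' + t *\<^sub>R y) - t * q y) \<le> flatten q y x"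
    if "t \<ge> 0" for t
    using sum_lower that by (intro flatten_greatest) (simp add: algebra_simps)
  then have "flatten q y (x + x') - flatten q y x \<le> flatten q y x'"
    by (intro flatten_greatest) (simp add: algebra_simps)
  then show "flatten q y (x + x') \<le> flatten q y x + flatten q y x'"
    by simp
next
  fix c :: real and x :: 'a
  assume "c \<ge> 0"
  have scaled: "flatten q y (c *\<^sub>R x) \<le> c * (q (x + t *\<^sub>R y) - t * q y)" if "t \<ge> 0" for t
  proof -
    have "flatten q y (c *\<^sub>R x) \<le> q (c *\<^sub>R x + (c * t) *\<^sub>R y) - (c * t) * q y"
      using that \<open>c \<ge> 0\<close> by (intro flatten_lower q) auto
    also have "c *\<^sub>R x + (c * t) *\<^sub>R y = c *\<^sub>R (x + t *\<^sub>R y)"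
      by (simp add: scaleR_add_right)
    also have "q \<dots> = c * q (x + t *\<^sub>R y)"
      by (rule sublinearD(2)[OF q \<open>c \<ge> 0\<close>])
    finally show ?thesis
      by (simp add: algebra_simps)
  qed
  show "flatten q y (c *\<^sub>R x) \<le> c * flatten q y x"
  proof (cases "c = 0")
    case True
    then show ?thesis
      using scaled[of 0] by simp
  next
    case False
    then have "flatten q y (c *\<^sub>R x) / c \<le> flatten q y x"
      using scaled \<open>c \<ge> 0\<close> by (intro flatten_greatest) (simp add: field_simps)
    then show ?thesis
      using False \<open>c \<ge> 0\<close> by (simp add: field_simps)
  qed
qed

text \<open>
  The pointwise infimum of a chain stays sublinear because any two members can be replaced by the
  smaller one, and it is finite because \<open>q x \<ge> - q (- x) \<ge> - p (- x)\<close> for all \<open>q \<le> p\<close>.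
\<close>

lemma sublinear_INF_chain:
  fixes p :: "'a::real_vector \<Rightarrow> real"
  assumes "C \<noteq> {}" and sub: "\<And>q. q \<in> C \<Longrightarrow> sublinear q" and le: "\<And>q. q \<in> C \<Longrightarrow> q \<le> p"
    and chain: "\<And>q r. q \<in> C \<Longrightarrow> r \<in> C \<Longrightarrow> q \<le> r \<or> r \<le> q"
  shows "sublinear (\<lambda>x. INF q\<in>C. q x)" and "q \<in> C \<Longrightarrow> (INF q\<in>C. q x) \<le> q x"
proof -
  define u where "u = (\<lambda>x. INF q\<in>C. q x)"
  have bdd: "bdd_below ((\<lambda>q. q x) ` C)" for x
  proof (rule bdd_belowI2)
    fix q
    assume "q \<in> C"
    then show "- p (- x) \<le> q x"
      using sublinear_minus_le[OF sub, of q x] le_funD[OF le, of q "- x"] by simp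
  qed
  have lower: "u x \<le> q x" if "q \<in> C" for q x
    unfolding u_def using bdd that by (rule cINF_lower)
  have greatest: "m \<le> u x" if "\<And>q. q \<in> C \<Longrightarrow> m \<le> q x" for m x
    unfolding u_def using \<open>C \<noteq> {}\<close> that by (rule cINF_greatest)
  have "sublinear u"
  proof (rule sublinearI)
    fix x y :: 'a
    have pair: "u (x + y) \<le> q x + r y" if qr: "q \<in> C" "r \<in> C" for q r
    proof -
      obtain s where s: "s \<in> C" "s \<le> q" "s \<le> r"
        using chain[OF qr] qr by auto
      have "u (x + y) \<le> s (x + y)"
        using s(1) by (rule lower)
      also have "\<dots> \<le> s x + s y"
        by (rule sublinearD(1)[OF sub[OF s(1)]])
      also have "\<dots> \<le> q x + r y"
        by (rule add_mono[OF le_funD[OF s(2)] le_funD[OF s(3)]])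
      finally show ?thesis .
    qed
    have "u (x + y) - r y \<le> u x" if "r \<in> C" for r
      using pair that by (intro greatest) (simp add: algebra_simps)
    then have "u (x + y) - u x \<le> u y"
      by (intro greatest) (simp add: algebra_simps)
    then show "u (x + y) \<le> u x + u y"
      by simp
  next
    fix c :: real and x :: 'a
    assume "c \<ge> 0"
    have scaled: "u (c *\<^sub>R x) \<le> c * q x" if "q \<in> C" for q
      using lower[OF that, of "c *\<^sub>R x"] sublinearD(2)[OF sub[OF that] \<open>c \<ge> 0\<close>, of x] by simp
    show "u (c *\<^sub>R x) \<le> c * u x"
    proof (cases "c = 0")
      case True
      then show ?thesis
        using scaled \<open>C \<noteq> {}\<close> by auto
    next
      case False
      then have "u (c *\<^sub>R x) / c \<le> u x"
        using scaled \<open>c \<ge> 0\<close> by (intro greatest) (simp add: field_simps)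
      then show ?thesis
        using False \<open>c \<ge> 0\<close> by (simp add: field_simps)
    qed
  qed
  then show "sublinear (\<lambda>x. INF q\<in>C. q x)"
    by (simp add: u_def)
  show "(INF q\<in>C. q x) \<le> q x" if "q \<in> C"
    using lower[OF that] by (simp add: u_def)
qed

lemma minimal_sublinear_exists:
  fixes p :: "'a::real_vector \<Rightarrow> real"
  assumes "sublinear p"
  shows "\<exists>q. sublinear q \<and> q \<le> p \<and> (\<forall>r. sublinear r \<and> r \<le> q \<longrightarrow> r = q)"
proof -
  define S where "S = {q. sublinear q \<and> q \<le> p}"
  have "\<exists>m\<in>S. \<forall>a\<in>S. m \<ge> a \<longrightarrow> a = m"
  proof (rule predicate_Zorn)
    show "partial_order_on S (relation_of (\<ge>) S)"
      by (rule partial_order_on_relation_ofI) auto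
    fix C
    assume "C \<in> Chains (relation_of (\<ge>) S)"
    then have C: "q \<in> S" "q \<le> r \<or> r \<le> q" if "q \<in> C" "r \<in> C" for q r
      using that by (auto simp: Chains_def relation_of_def)
    show "\<exists>u\<in>S. \<forall>a\<in>C. a \<ge> u"
    proof (cases "C = {}")
      case True
      then show ?thesis
        using assms by (auto simp: S_def)
    next
      case False
      define u where "u = (\<lambda>x. INF q\<in>C. q x)"
      have "sublinear u"
        unfolding u_def
        by (rule sublinear_INF_chain(1)[OF False, of p]) (use C in \<open>auto simp: S_def\<close>)
      moreover have le: "u \<le> q" if "q \<in> C" for q
        unfolding u_def
        by (rule le_funI, rule sublinear_INF_chain(2)[OF False, of p])
          (use C that in \<open>auto simp: S_def\<close>)
      moreover have "u \<le> p"
        using False le C(1) order_trans unfolding S_def by blast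
      ultimately show ?thesis
        unfolding S_def by blast
    qed
  qed
  then show ?thesis
    unfolding S_def using order_trans by blast
qed

text \<open>
  Minimality forces \<open>q = flatten q y\<close>; the term with \<open>t = 1\<close> in the infimum then reads
  \<open>q x \<le> q (x + y) - q y\<close>, the inequality opposite to subadditivity.
\<close>

lemma minimal_sublinear_linear:
  fixes q :: "'a::real_vector \<Rightarrow> real"
  assumes q: "sublinear q" and minimal: "\<And>r. sublinear r \<Longrightarrow> r \<le> q \<Longrightarrow> r = q"
  shows "linear q"
proof -
  have "flatten q y = q" for y
    by (rule minimal[OF sublinear_flatten[OF q]], rule le_funI, rule flatten_le[OF q])
  then have "q x \<le> q (x + y) - q y" for x y
    using flatten_lower[OF q, of 1 y x] by simp
  then have add: "q (x + y) = q x + q y" for x y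
    using sublinearD(1)[OF q, of x y] by (simp add: le_diff_eq order_antisym)
  have minus: "q (- x) = - q x" for x
    using add[of x "- x"] sublinear_zero[OF q] by simp
  have "q (c *\<^sub>R x) = c * q x" for c x
  proof (cases "c \<ge> 0")
    case True
    then show ?thesis
      by (rule sublinearD(2)[OF q])
  next
    case False
    then have "q (- (c *\<^sub>R x)) = - c * q x"
      using sublinearD(2)[OF q, of "- c" x] by simp
    then show ?thesis
      by (simp add: minus)
  qed
  then show ?thesis
    using add by (intro linearI) auto
qed

text \<open>
  Flattening the norm along \<open>x\<close> before minimising fixes the value at \<open>x\<close>: every linear \<open>f\<close> below
  \<open>flatten norm x\<close> satisfies \<open>f (- x) \<le> - norm x\<close>, that is, \<open>f x \<ge> norm x\<close>.
\<close>

lemma norming_functional: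
  fixes x :: "'a::real_normed_vector"
  assumes "x \<noteq> 0"
  shows "\<exists>f :: 'a \<Rightarrow>\<^sub>L real. norm f = 1 \<and> blinfun_apply f x = norm x"
proof -
  obtain q where q: "sublinear q" "q \<le> flatten norm x"
      and minimal: "\<And>r. sublinear r \<Longrightarrow> r \<le> q \<Longrightarrow> r = q"
    using minimal_sublinear_exists[OF sublinear_flatten[OF sublinear_norm, of x]] by blast
  have "linear q"
    using q(1) minimal by (rule minimal_sublinear_linear)
  have le_norm: "q y \<le> norm y" for y
    using le_funD[OF q(2), of y] flatten_le[OF sublinear_norm, of x y] by simp
  have abs_le: "\<bar>q y\<bar> \<le> norm y" for y
    using le_norm[of y] le_norm[of "- y"] linear_neg[OF \<open>linear q\<close>, of y] by simp
  have "q (- x) \<le> - norm x"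
    using le_funD[OF q(2), of "- x"] flatten_lower[OF sublinear_norm, of 1 x "- x"] by simp
  then have qx: "q x = norm x"
    using le_norm[of x] linear_neg[OF \<open>linear q\<close>, of x] by simp
  have "bounded_linear q"
    using abs_le linear_add[OF \<open>linear q\<close>] linear_scale[OF \<open>linear q\<close>]
    by (intro bounded_linear_intro[of q 1]) auto
  then have Blinfun_q: "blinfun_apply (Blinfun q) = q"
    by (rule bounded_linear_Blinfun_apply)
  have "norm (Blinfun q) = 1"
  proof (rule antisym)
    show "norm (Blinfun q) \<le> 1"
      using abs_le by (intro norm_blinfun_bound) (auto simp: Blinfun_q)
    show "1 \<le> norm (Blinfun q)"
      using norm_blinfun[of "Blinfun q" x] qx assms by (simp add: Blinfun_q)
  qed
  then show ?thesis
    using Blinfun_q qx by auto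
qed

lemma norm_bidual_embed [simp]: "norm (bidual_embed x) = norm x"
proof (rule antisym)
  show "norm (bidual_embed x) \<le> norm x"
  proof (rule norm_blinfun_bound)
    show "norm (blinfun_apply (bidual_embed x) f) \<le> norm x * norm f" for f
      using norm_blinfun[of f x] by (simp add: mult.commute[of "norm x"])
  qed simp
next
  show "norm x \<le> norm (bidual_embed x)"
  proof (cases "x = 0")
    case False
    then obtain f :: "'a \<Rightarrow>\<^sub>L real" where "norm f = 1" "blinfun_apply f x = norm x"
      using norming_functional[OF False] by blast
    then show ?thesis
      using norm_blinfun[of "bidual_embed x" f] by simp
  qed simp
qed

lemma inj_bidual_embed: "inj (bidual_embed :: 'a::real_normed_vector \<Rightarrow> _)"
proof (rule injI)
  fix x y :: 'a
  assume eq: "bidual_embed x = bidual_embed y"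
  have "blinfun_apply f (x - y) = 0" for f :: "'a \<Rightarrow>\<^sub>L real"
    using arg_cong[OF eq, of "\<lambda>F. blinfun_apply F f"] by (simp add: blinfun.diff_right)
  then have "bidual_embed (x - y) = 0"
    by (intro blinfun_eqI) simp
  then show "x = y"
    using norm_bidual_embed[of "x - y"] by simp
qed

section \<open>Dense subsets of spans\<close>

text \<open>
  Sorting the rational combinations by their number of terms allows their cardinality to be bounded
  by induction.
\<close>

primrec rational_combinations :: "'a::real_vector set \<Rightarrow> nat \<Rightarrow> 'a set"
  where
    "rational_combinations A 0 = {0}"
  | "rational_combinations A (Suc n) =
      (\<lambda>(y, q, a). of_rat q *\<^sub>R a + y) ` (rational_combinations A n \<times> (UNIV :: rat set) \<times> A)"

lemma rational_combinations_subset_span: "rational_combinations A n \<subseteq> span A"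
  by (induction n) (auto intro: span_add span_scale span_base simp: span_zero)

lemma span_subset_closure_rational_combinations:
  fixes A :: "'a::real_normed_vector set"
  shows "span A \<subseteq> closure (\<Union>n. rational_combinations A n)"
proof
  fix x
  assume "x \<in> span A"
  then show "x \<in> closure (\<Union>n. rational_combinations A n)"
  proof (induction rule: span_induct_alt)
    case base
    have "0 \<in> (\<Union>n. rational_combinations A n)"
      by (rule UN_I[of 0]) auto
    then show ?case
      by (rule subsetD[OF closure_subset])
  next
    case (step c a y)
    obtain s where s: "\<And>n. s n \<in> (\<Union>n. rational_combinations A n)" "s \<longlonglongrightarrow> y"
      using step.IH unfolding closure_sequential by (auto simp del: UN_iff)
    have "c \<in> closure \<rat>"
      by (simp add: Rats_closure_real)
    then obtain r where r: "\<And>n. r n \<in> \<rat>" "r \<longlonglongrightarrow> c"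
      unfolding closure_sequential by blast
    have "\<forall>n. r n *\<^sub>R a + s n \<in> (\<Union>n. rational_combinations A n)"
    proof
      fix n
      obtain m where m: "s n \<in> rational_combinations A m"
        using s(1) by blast
      obtain q where "r n = of_rat q"
        using r(1)[of n] by (auto elim: Rats_cases)
      then have "r n *\<^sub>R a + s n \<in> rational_combinations A (Suc m)"
        using m step.hyps by force
      then show "r n *\<^sub>R a + s n \<in> (\<Union>n. rational_combinations A n)"
        by (rule UN_I[OF UNIV_I])
    qed
    moreover have "(\<lambda>n. r n *\<^sub>R a + s n) \<longlonglongrightarrow> c *\<^sub>R a + y"
      using r(2) s(2) by (intro tendsto_intros)
    ultimately show ?case
      unfolding closure_sequential by (intro exI[of _ "\<lambda>n. r n *\<^sub>R a + s n"] conjI)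
  qed
qed

text \<open>
  Adjoining a copy of \<open>\<nat>\<close> to \<open>A\<close> makes the bound infinite, so that it absorbs the rational
  coefficients and the union over all lengths, including when \<open>A\<close> is finite.
\<close>

lemma card_rational_combinations:
  "|\<Union>n. rational_combinations A n| \<le>o |A <+> (UNIV :: nat set)|"
proof -
  let ?M = "A <+> (UNIV :: nat set)"
  have inf: "\<not> finite ?M"
    by simp
  have nat: "|UNIV :: nat set| \<le>o |?M|"
    by (rule card_of_Plus2)
  have "|UNIV :: rat set| \<le>o |UNIV :: nat set|"
    by (rule card_of_ordLeqI[of to_nat]) auto
  then have rat: "|UNIV :: rat set| \<le>o |?M|"
    using nat ordLeq_transitive by blast
  have inf_Field: "\<not> finite (Field |?M| )"
    using inf by (simp only: Field_card_of not_False_eq_True)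
  note times = card_of_Times_ordLeq_infinite_Field[OF inf_Field _ _ card_of_Card_order]
  have "|(UNIV :: rat set) \<times> A| \<le>o |?M|"
    by (rule times[OF rat card_of_Plus1])
  note step = times[OF _ this]
  have "|rational_combinations A n| \<le>o |?M|" for n
  proof (induction n)
    case 0
    then show ?case
      using inf by (simp add: card_of_singl_ordLeq)
  next
    case (Suc n)
    show ?case
      unfolding rational_combinations.simps
      by (rule ordLeq_transitive[OF card_of_image step[OF Suc.IH]])
  qed
  then show ?thesis
    using card_of_UNION_ordLeq_infinite[OF inf nat] by blast
qed

lemma density_character_span_less:
  fixes A :: "'a::real_normed_vector set"
  assumes \<kappa>: "Card_order \<kappa>" "natLeq <o \<kappa>" and A: "|A| <o \<kappa>"
  shows "density_character (span A) <o \<kappa>"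
proof -
  have "|UNIV :: nat set| <o \<kappa>"
    using card_of_nat \<kappa>(2) ordIso_ordLess_trans by blast
  moreover have "\<not> finite (Field \<kappa>)"
    using \<kappa> by (meson infinite_iff_natLeq_ordLeq ordLess_imp_ordLeq
        card_of_Field_ordIso ordIso_symmetric ordLeq_ordIso_trans)
  ultimately have "|A <+> (UNIV :: nat set)| <o \<kappa>"
    using \<kappa>(1) A by (intro card_of_Plus_ordLess_infinite_Field)
  then have "|\<Union>n. rational_combinations A n| <o \<kappa>"
    using card_rational_combinations ordLeq_ordLess_trans by blast
  moreover have "(\<Union>n. rational_combinations A n) \<subseteq> span A"
    using rational_combinations_subset_span by blast
  ultimately show ?thesis
    unfolding density_character_less_iff
    using span_subset_closure_rational_combinations[of A]
    by (intro exI[of _ "\<Union>n. rational_combinations A n"] conjI)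
qed

section \<open>Norming sets and norms of sums\<close>

lemma fails_minus_one_BCP_imp_norm_add_eq_2:
  fixes \<kappa> :: "'k rel" and A :: "'a::real_normed_vector set"
  assumes \<kappa>: "Cinfinite \<kappa>" and fails: "fails_minus_one_BCP_lt TYPE('a) \<kappa>"
    and A: "A \<subseteq> sphere 0 1" "|A| <o \<kappa>"
  shows "\<exists>z\<in>sphere 0 1. \<forall>x\<in>A. norm (x + z) = 2"
proof -
  have "natLeq \<le>o \<kappa>"
    using \<kappa> by (rule natLeq_ordLeq_cinfinite)
  then consider "natLeq <o \<kappa>" | "natLeq =o \<kappa>"
    using ordLeq_iff_ordLess_or_ordIso by blast
  then show ?thesis
  proof cases
    case 1
    then have "density_character (span A) <o \<kappa>"
      using \<kappa> A(2) by (intro density_character_span_less) auto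
    then obtain z where z: "z \<in> sphere 0 1"
        and ge: "\<And>y t. y \<in> span A \<Longrightarrow> norm (y + t *\<^sub>R z) \<ge> norm y + \<bar>t\<bar>"
      using fails 1 unfolding fails_minus_one_BCP_lt_def by (metis subspace_span)
    have "norm (x + z) = 2" if "x \<in> A" for x
    proof (rule antisym)
      have "norm x = 1"
        using that A(1) by auto
      then show "norm (x + z) \<ge> 2"
        using ge[OF span_base[OF that], of 1] by simp
      show "norm (x + z) \<le> 2"
        using norm_triangle_ineq[of x z] \<open>norm x = 1\<close> z by simp
    qed
    then show ?thesis
      using z by blast
  next
    case 2
    then have "finite A"
      using ordLess_ordIso_trans[OF A(2) ordIso_symmetric[OF 2]]
      by (simp add: finite_iff_ordLess_natLeq)
    then show ?thesis
      using fails ordIso_symmetric[OF 2] A(1) unfolding fails_minus_one_BCP_lt_def by blast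
  qed
qed

text \<open>
  The weak* properties quantify over sets of evaluation functionals on the dual; since the embedding
  is isometric, these are the images of sets of unit vectors of the same cardinality.
\<close>

lemma sphere_range_bidual_embedE:
  fixes A :: "(('a::real_normed_vector \<Rightarrow>\<^sub>L real) \<Rightarrow>\<^sub>L real) set"
  assumes "A \<subseteq> sphere 0 1 \<inter> range bidual_embed" and "|A| <o \<kappa>"
  obtains A' :: "'a set" where "A = bidual_embed ` A'" "A' \<subseteq> sphere 0 1" "|A'| <o \<kappa>"
proof -
  define A' :: "'a set" where "A' = bidual_embed -` A"
  have "A = bidual_embed ` A'"
    using assms(1) by (auto simp: A'_def)
  moreover have "A' \<subseteq> sphere 0 1"
    using assms(1) norm_bidual_embed by (fastforce simp: A'_def)
  moreover have "|A'| \<le>o |A|"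
    using inj_bidual_embed by (intro card_of_ordLeqI[of bidual_embed])
      (auto simp: A'_def inj_on_def)
  then have "|A'| <o \<kappa>"
    using assms(2) by (rule ordLeq_ordLess_trans)
  ultimately show ?thesis
    using that by blast
qed

lemma lnorms_bidual_embed_image:
  fixes A :: "'a::real_normed_vector set"
  assumes "A \<subseteq> sphere 0 1" and "B \<subseteq> sphere 0 1"
  shows "lnorms l B (bidual_embed ` A) \<longleftrightarrow> (\<forall>x\<in>A. \<exists>f\<in>B. l \<le> blinfun_apply f x)"
proof -
  have "B - {0} = B"
    using assms(2) by auto
  moreover have "norm x = 1" if "x \<in> A" for x
    using assms(1) that by auto
  moreover have "norm f = 1" if "f \<in> B" for f
    using assms(2) that by auto
  ultimately show ?thesis
    unfolding lnorms_def by simp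
qed

text \<open>
  The norm of \<open>x + z\<close> is attained by some \<open>f\<close>, and \<open>f x + f z = 2\<close> leaves no room: both summands
  are \<open>1\<close>.
\<close>

lemma fails_minus_one_BCP_imp_weak_star_one_ASD2P:
  fixes \<kappa> :: "'k rel"
  assumes \<kappa>: "Cinfinite \<kappa>" and fails: "fails_minus_one_BCP_lt TYPE('a::real_normed_vector) \<kappa>"
  shows "weak_star_one_ASD2P_lt TYPE('a) \<kappa>"
  unfolding weak_star_one_ASD2P_lt_def one_ASD2P_lt_def
proof (intro allI impI, elim conjE)
  fix A :: "(('a \<Rightarrow>\<^sub>L real) \<Rightarrow>\<^sub>L real) set"
  assume "A \<subseteq> sphere 0 1 \<inter> range bidual_embed" "|A| <o \<kappa>"
  then obtain A' :: "'a set"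
    where A': "A = bidual_embed ` A'" "A' \<subseteq> sphere 0 1" "|A'| <o \<kappa>"
    by (rule sphere_range_bidual_embedE)
  obtain z where z: "z \<in> sphere 0 1" "\<And>x. x \<in> A' \<Longrightarrow> norm (x + z) = 2"
    using fails_minus_one_BCP_imp_norm_add_eq_2[OF \<kappa> fails A'(2,3)] by blast
  define B :: "('a \<Rightarrow>\<^sub>L real) set" where "B = {f \<in> sphere 0 1. blinfun_apply f z = 1}"
  have B: "B \<subseteq> sphere 0 1" "\<forall>f\<in>B. blinfun_apply (bidual_embed z) f = 1"
    by (auto simp: B_def)
  have "\<exists>f\<in>B. blinfun_apply f x = 1" if "x \<in> A'" for x
  proof -
    have x: "norm x = 1" "norm (x + z) = 2"
      using that A'(2) z(2) by auto
    then have "x + z \<noteq> 0"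
      by auto
    then obtain f :: "'a \<Rightarrow>\<^sub>L real" where f: "norm f = 1" "blinfun_apply f (x + z) = 2"
      using norming_functional x(2) by metis
    have "blinfun_apply f x \<le> 1" "blinfun_apply f z \<le> 1"
      using norm_blinfun[of f x] norm_blinfun[of f z] f(1) x(1) z(1) by auto
    then have "blinfun_apply f x = 1 \<and> blinfun_apply f z = 1"
      using f(2) by (simp add: blinfun.add_right)
    then show ?thesis
      using f(1) by (auto simp: B_def)
  qed
  then have "norms B A"
    unfolding norms_def A'(1) lnorms_bidual_embed_image[OF A'(2) B(1)]
    by (metis greaterThanLessThan_iff less_imp_le)
  moreover have "bidual_embed z \<in> sphere 0 1"
    using z(1) by simp
  ultimately show "\<exists>B (f :: ('a \<Rightarrow>\<^sub>L real) \<Rightarrow>\<^sub>L real). B \<subseteq> sphere 0 1 \<and> f \<in> sphere 0 1 \<and> norms B A \<and>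
      (\<forall>x\<in>B. blinfun_apply f x = 1)"
    using B by blast
qed

lemma weak_star_one_ASD2P_imp_norm_add_eq_2:
  fixes \<kappa> :: "'k rel" and A :: "'a::real_normed_vector set"
  assumes asd: "weak_star_one_ASD2P_lt TYPE('a) \<kappa>"
    and A: "A \<subseteq> sphere 0 1" "|A| <o \<kappa>"
  shows "\<exists>xss\<in>sphere 0 1. \<forall>x\<in>A. norm (bidual_embed x + xss) = 2"
proof -
  have "|bidual_embed ` A| <o \<kappa>"
    using card_of_image A(2) by (rule ordLeq_ordLess_trans)
  moreover have "bidual_embed ` A \<subseteq> sphere 0 1 \<inter> range bidual_embed"
    using A(1) by auto
  ultimately obtain B and xss :: "('a \<Rightarrow>\<^sub>L real) \<Rightarrow>\<^sub>L real"
    where B: "B \<subseteq> sphere 0 1" and xss: "xss \<in> sphere 0 1"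
      and norms: "norms B (bidual_embed ` A)" and one: "\<forall>f\<in>B. blinfun_apply xss f = 1"
    using asd[unfolded weak_star_one_ASD2P_lt_def one_ASD2P_lt_def, rule_format,
        of "bidual_embed ` A"] by blast
  have "norm (bidual_embed x + xss) = 2" if "x \<in> A" for x
  proof (rule antisym)
    have x: "norm x = 1"
      using that A(1) by auto
    then show "norm (bidual_embed x + xss) \<le> 2"
      using norm_triangle_ineq[of "bidual_embed x" xss] xss by simp
    have "l \<le> norm (bidual_embed x + xss) - 1" if l: "0 < l" "l < 1" for l
    proof -
      have "lnorms l B (bidual_embed ` A)"
        using norms l by (simp add: norms_def)
      then obtain f where f: "f \<in> B" "l \<le> blinfun_apply f x"
        unfolding lnorms_bidual_embed_image[OF A(1) B] using \<open>x \<in> A\<close> by blast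
      then have "norm f = 1"
        using B by auto
      then have "l + 1 \<le> blinfun_apply (bidual_embed x + xss) f"
        using f one by (simp add: blinfun.add_left)
      also have "\<dots> \<le> norm (bidual_embed x + xss)"
        using norm_blinfun[of "bidual_embed x + xss" f] \<open>norm f = 1\<close> by simp
      finally show ?thesis
        by simp
    qed
    then have "1 \<le> norm (bidual_embed x + xss) - 1"
      by (intro dense_le_bounded[of 0 1]) auto
    then show "2 \<le> norm (bidual_embed x + xss)"
      by simp
  qed
  then show ?thesis
    using xss by blast
qed

lemma unit_vector_nearly_norming:
  fixes g :: "'a::real_normed_vector \<Rightarrow>\<^sub>L real"
  assumes "0 \<le> c" "c < norm g"
  shows "\<exists>x. norm x = 1 \<and> c < blinfun_apply g x"
proof -
  have "\<exists>y. c * norm y < \<bar>blinfun_apply g y\<bar>"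
  proof (rule ccontr)
    assume "\<nexists>y. c * norm y < \<bar>blinfun_apply g y\<bar>"
    then have "norm g \<le> c"
      using assms(1) by (intro norm_blinfun_bound) (simp_all add: not_less)
    then show False
      using assms(2) by simp
  qed
  then obtain y where y: "c * norm y < \<bar>blinfun_apply g y\<bar>"
    by blast
  then have "y \<noteq> 0"
    by (auto simp: blinfun.zero_right)
  define x where "x = (sgn (blinfun_apply g y) / norm y) *\<^sub>R y"
  have "blinfun_apply g y \<noteq> 0"
    using y mult_nonneg_nonneg[OF assms(1) norm_ge_zero[of y]] by auto
  then have "norm x = 1"
    using \<open>y \<noteq> 0\<close> by (simp add: x_def abs_sgn_eq)
  moreover have "blinfun_apply g x = \<bar>blinfun_apply g y\<bar> / norm y"
    by (simp add: x_def blinfun.scaleR_right abs_sgn mult.commute)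
  then have "c < blinfun_apply g x"
    using y \<open>y \<noteq> 0\<close> by (simp add: pos_less_divide_eq)
  ultimately show ?thesis
    by blast
qed

text \<open>
  A unit \<open>f\<close> at which \<open>x + x**\<close> exceeds \<open>1 + l\<close> has both values at least \<open>l\<close>, as neither exceeds
  \<open>1\<close>.
\<close>

lemma norm_add_eq_2_imp_weak_star_SD2P:
  fixes \<kappa> :: "'k rel"
  assumes eq_2: "\<And>A :: 'a::real_normed_vector set. A \<subseteq> sphere 0 1 \<Longrightarrow> |A| <o \<kappa> \<Longrightarrow>
    \<exists>xss\<in>sphere 0 1. \<forall>x\<in>A. norm (bidual_embed x + xss) = 2"
  shows "weak_star_SD2P_lt TYPE('a) \<kappa>"
  unfolding weak_star_SD2P_lt_def SD2P_lt_def
proof (intro allI impI ballI, elim conjE)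
  fix A :: "(('a \<Rightarrow>\<^sub>L real) \<Rightarrow>\<^sub>L real) set" and l :: real
  assume "A \<subseteq> sphere 0 1 \<inter> range bidual_embed" "|A| <o \<kappa>" and l: "l \<in> {0<..<1}"
  then obtain A' :: "'a set"
    where A': "A = bidual_embed ` A'" "A' \<subseteq> sphere 0 1" "|A'| <o \<kappa>"
    by (blast elim: sphere_range_bidual_embedE)
  obtain xss where xss: "xss \<in> sphere 0 1" "\<And>x. x \<in> A' \<Longrightarrow> norm (bidual_embed x + xss) = 2"
    using eq_2[OF A'(2,3)] by blast
  define B where "B = {f \<in> sphere 0 1. blinfun_apply xss f \<ge> l}"
  have B: "B \<subseteq> sphere 0 1" "\<forall>f\<in>B. blinfun_apply xss f \<ge> l"
    by (auto simp: B_def)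
  have "\<exists>f\<in>B. l \<le> blinfun_apply f x" if "x \<in> A'" for x
  proof -
    have x: "norm x = 1" "norm (bidual_embed x + xss) = 2"
      using that A'(2) xss(2) by auto
    obtain f where f: "norm f = 1" "1 + l < blinfun_apply (bidual_embed x + xss) f"
      using unit_vector_nearly_norming[of "1 + l" "bidual_embed x + xss"] x(2) l by auto
    have "blinfun_apply f x \<le> 1" "blinfun_apply xss f \<le> 1"
      using norm_blinfun[of f x] norm_blinfun[of xss f] f(1) x(1) xss(1) by auto
    then have "blinfun_apply f x \<ge> l" "blinfun_apply xss f \<ge> l"
      using f(2) by (auto simp: blinfun.add_left)
    then show ?thesis
      using f(1) by (auto simp: B_def)
  qed
  then have "lnorms l B A"
    unfolding A'(1) lnorms_bidual_embed_image[OF A'(2) B(1)] by blast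
  then show "\<exists>B f. B \<subseteq> sphere 0 1 \<and> f \<in> sphere 0 1 \<and> lnorms l B A \<and>
      (\<forall>x\<in>B. blinfun_apply f x \<ge> l)"
    using B xss(1) by blast
qed

theorem proposition3p4:
  fixes \<kappa> :: "'k rel"
  assumes infinite_dim: "\<not> (\<exists>S::'a::banach set. finite S \<and> span S = UNIV)"
    and infinite_card: "Cinfinite \<kappa>"
  shows "(fails_minus_one_BCP_lt TYPE('a) \<kappa> \<longrightarrow> weak_star_one_ASD2P_lt TYPE('a) \<kappa>) \<and>
    (weak_star_one_ASD2P_lt TYPE('a) \<kappa> \<longrightarrow>
      (\<forall>A::'a set. A \<subseteq> sphere 0 1 \<and> |A| <o \<kappa> \<longrightarrow>
        (\<exists>xss\<in>sphere 0 1. \<forall>x\<in>A. norm (bidual_embed x + xss) = 2))) \<and>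
    ((\<forall>A::'a set. A \<subseteq> sphere 0 1 \<and> |A| <o \<kappa> \<longrightarrow>
        (\<exists>xss\<in>sphere 0 1. \<forall>x\<in>A. norm (bidual_embed x + xss) = 2)) \<longrightarrow>
      weak_star_SD2P_lt TYPE('a) \<kappa>)"
proof (intro conjI impI allI)
  show "weak_star_one_ASD2P_lt TYPE('a) \<kappa>" if "fails_minus_one_BCP_lt TYPE('a) \<kappa>"
    using infinite_card that by (rule fails_minus_one_BCP_imp_weak_star_one_ASD2P)
  show "\<exists>xss\<in>sphere 0 1. \<forall>x\<in>A. norm (bidual_embed x + xss) = 2"
    if "weak_star_one_ASD2P_lt TYPE('a) \<kappa>" "A \<subseteq> sphere 0 1 \<and> |A| <o \<kappa>" for A :: "'a set"
    using that by (intro weak_star_one_ASD2P_imp_norm_add_eq_2) auto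
  show "weak_star_SD2P_lt TYPE('a) \<kappa>"
    if "\<forall>A::'a set. A \<subseteq> sphere 0 1 \<and> |A| <o \<kappa> \<longrightarrow>
      (\<exists>xss\<in>sphere 0 1. \<forall>x\<in>A. norm (bidual_embed x + xss) = 2)"
    using that by (intro norm_add_eq_2_imp_weak_star_SD2P) blast
qed

end
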